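(* Let $Q$ be a combinatorially symmetric $S\times S$ transition rate matrix of a continuous-time homogeneous Markov chain with graph $\mathcal{G}(Q)$, and let $Z\subseteq\{1,\ldots,S\}$ be a set of observed states that is a zero forcing set of $\mathcal{G}(Q)$. Then the Markov chain is uniquely determined by the dynamics of the observed states. That is, if $Q'$ is any combinatorially symmetric $S\times S$ transition rate matrix with $\mathcal{G}(Q')=\mathcal{G}(Q)$ and $(\exp(Q't))_{ij}=(\exp(Qt))_{ij}$ for all $i,j\in Z$ and all $t\ge 0$, then $Q'=Q$.
   Context: Markov chains are homogeneous and finite with states $1,\ldots,S$. A transition rate matrix is a real $S\times S$ matrix $Q$ with $(Q)_{ij}\ge 0$ for $i\neq j$ and $(Q)_{ii}=-\sum_{j\neq i}(Q)_{ij}$ for all $i$. The corresponding transition matrix at time $t\in\mathbb{R}_{\ge 0}$ is $P(t)=\exp(Qt)$. A matrix $M$ is combinatorially symmetric if for all indices $i,j$, $(M)_{ij}\neq 0$ implies $(M)_{ji}\neq 0$. For a combinatorially symmetric matrix $M$ of order $S$, $\mathcal{G}(M)$ is the simple undirected graph on the vertices $1,\ldots,S$ in which $\{i,j\}$ with $i<j$ is an edge if and only if $(M)_{ij}\neq 0$ (diagonal entries are ignored). Zero forcing: given a simple graph, colour the vertices of a subset $Z$ blue. The colour propagates by the rules: (1) a blue vertex remains blue; (2) if a blue vertex $i$ has exactly one non-blue neighbour $j$, then $j$ becomes blue. $Z$ is a zero forcing set if eventually all vertices become blue. The dynamics of the observed states $Z$ is the collection of all values $P(t)_{ij}$ with $i,j\in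 Z$ and $t\ge 0$. The structure of the model (its graph) is regarded as known, and the matrix entries are the unknown parameters. *)

theory Defs
  imports "HOL-Analysis.Analysis"
begin

text \<open>
  The states are the elements of a finite type \<open>'n\<close>, so that \<open>S\<close> is \<open>CARD('n)\<close>.
\<close>

definition transition_rate_matrix :: "real^'n^'n \<Rightarrow> bool" where
  "transition_rate_matrix Q \<longleftrightarrow>
     (\<forall>i j. i \<noteq> j \<longrightarrow> Q $ i $ j \<ge> 0) \<and>
     (\<forall>i. Q $ i $ i = - (\<Sum>j\<in>UNIV - {i}. Q $ i $ j))"

text \<open>
  Powers with respect to the matrix product \<open>**\<close>; the overloaded \<open>*\<close> and \<open>^\<close> on type \<open>vec\<close>
  are componentwise, and the class-based \<open>exp\<close> is not available for it.
\<close>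

primrec matrix_pow :: "real^'n^'n \<Rightarrow> nat \<Rightarrow> real^'n^'n" where
  "matrix_pow A 0 = mat 1"
| "matrix_pow A (Suc k) = A ** matrix_pow A k"

definition matrix_exp :: "real^'n^'n \<Rightarrow> real^'n^'n" where
  "matrix_exp A = (\<Sum>k. (1 / fact k) *\<^sub>R matrix_pow A k)"

lemma abs_matrix_pow_le:
  fixes A :: "real^'n^'n"
  shows "\<bar>matrix_pow A k $ i $ j\<bar> \<le> (\<Sum>i\<in>UNIV. \<Sum>j\<in>UNIV. \<bar>A $ i $ j\<bar>) ^ k"
proof (induction k arbitrary: i j)
  case 0
  show ?case by (simp add: mat_def)
next
  case (Suc k)
  let ?K = "\<Sum>i\<in>UNIV. \<Sum>j\<in>UNIV. \<bar>A $ i $ j\<bar>"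
  have K: "?K \<ge> 0" by (simp add: sum_nonneg)
  have "\<bar>matrix_pow A (Suc k) $ i $ j\<bar> = \<bar>\<Sum>l\<in>UNIV. A $ i $ l * matrix_pow A k $ l $ j\<bar>"
    by (simp add: matrix_matrix_mult_def)
  also have "\<dots> \<le> (\<Sum>l\<in>UNIV. \<bar>A $ i $ l\<bar> * \<bar>matrix_pow A k $ l $ j\<bar>)"
    unfolding abs_mult[symmetric] by (rule sum_abs)
  also have "\<dots> \<le> (\<Sum>l\<in>UNIV. \<bar>A $ i $ l\<bar> * ?K ^ k)"
    by (intro sum_mono mult_left_mono Suc.IH) simp
  also have "\<dots> = (\<Sum>l\<in>UNIV. \<bar>A $ i $ l\<bar>) * ?K ^ k"
    by (simp add: sum_distrib_right)
  also have "\<dots> \<le> ?K * ?K ^ k"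
    using K by (intro mult_right_mono member_le_sum) (auto simp: sum_nonneg)
  finally show ?case by simp
qed

lemma matrix_exp_sums:
  fixes A :: "real^'n^'n"
  shows "(\<lambda>k. (1 / fact k) *\<^sub>R matrix_pow A k) sums matrix_exp A"
proof -
  let ?K = "\<Sum>i\<in>UNIV. \<Sum>j\<in>UNIV. \<bar>A $ i $ j\<bar>"
  let ?N = "real CARD('n)"
  have bound: "norm ((1 / fact k) *\<^sub>R matrix_pow A k) \<le> (?N * ?N) * (?K ^ k /\<^sub>R fact k)" for k
  proof -
    have row: "norm (matrix_pow A k $ i) \<le> ?N * ?K ^ k" for i
    proof -
      have "norm (matrix_pow A k $ i) \<le> (\<Sum>j\<in>UNIV. \<bar>matrix_pow A k $ i $ j\<bar>)"
        by (rule norm_le_l1_cart)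
      also have "\<dots> \<le> (\<Sum>j\<in>(UNIV::'n set). ?K ^ k)"
        by (intro sum_mono abs_matrix_pow_le)
      finally show ?thesis by simp
    qed
    have "norm (matrix_pow A k) \<le> (\<Sum>i\<in>UNIV. norm (matrix_pow A k $ i))"
      unfolding norm_vec_def by (rule L2_set_le_sum) simp
    also have "\<dots> \<le> (\<Sum>i\<in>(UNIV::'n set). ?N * ?K ^ k)"
      by (intro sum_mono row)
    finally have "norm (matrix_pow A k) \<le> ?N * ?N * ?K ^ k" by simp
    then show ?thesis by (simp add: field_simps)
  qed
  have "summable (\<lambda>k. (1 / fact k) *\<^sub>R matrix_pow A k)"
    by (rule summable_comparison_test'[OF summable_mult[OF summable_exp_generic]]) (rule bound)
  then show ?thesis
    unfolding matrix_exp_def by (rule summable_sums)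
qed

definition transition_matrix :: "real^'n^'n \<Rightarrow> real \<Rightarrow> real^'n^'n" where
  "transition_matrix Q t = matrix_exp (t *\<^sub>R Q)"

definition combinatorially_symmetric :: "real^'n^'n \<Rightarrow> bool" where
  "combinatorially_symmetric M \<longleftrightarrow> (\<forall>i j. M $ i $ j \<noteq> 0 \<longrightarrow> M $ j $ i \<noteq> 0)"

text \<open>
  A simple graph on the vertex set \<open>UNIV :: 'n set\<close> is given by its set of edges, an edge being
  a two-element set. No order on \<open>'n\<close> is needed to pick one of the entries \<open>(i, j)\<close> and \<open>(j, i)\<close>:
  for combinatorially symmetric \<open>M\<close> they are zero or nonzero together.
\<close>

definition matrix_graph :: "real^'n^'n \<Rightarrow> 'n set set" where
  "matrix_graph M = {{i, j} | i j. i \<noteq> j \<and> M $ i $ j \<noteq> 0}"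

definition neighbours :: "'v set set \<Rightarrow> 'v \<Rightarrow> 'v set" where
  "neighbours E i = {j. j \<noteq> i \<and> {i, j} \<in> E}"

text \<open>One round of colouring, in which all forces available for the blue set \<open>B\<close> are performed.\<close>

definition force_step :: "'v set set \<Rightarrow> 'v set \<Rightarrow> 'v set" where
  "force_step E B = B \<union> {j. \<exists>i\<in>B. neighbours E i - B = {j}}"

definition zero_forcing_set :: "'v set set \<Rightarrow> 'v set \<Rightarrow> bool" where
  "zero_forcing_set E Z \<longleftrightarrow> (\<exists>n. (force_step E ^^ n) Z = UNIV)"

end

theory Submission
  imports Defs "HOL-Complex_Analysis.Cauchy_Integral_Formula"
begin

text \<open>
  Comparing Taylor coefficients at \<open>t = 0\<close>, the dynamics of \<open>Z\<close> amount to the entries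
  \<open>(Q ^ k)\<^sub>i\<^sub>j\<close> with \<open>i, j \<in> Z\<close> for all \<open>k\<close>. Along a zero forcing process these determine \<open>Q\<close> up to a
  diagonal similarity: there is a nowhere vanishing \<open>d\<close>, equal to \<open>1\<close> on \<open>Z\<close>, with
  \<open>Q'\<^sub>i\<^sub>j d\<^sub>j = d\<^sub>i Q\<^sub>i\<^sub>j\<close>. As the rows of \<open>Q\<close> and \<open>Q'\<close> sum to zero, \<open>d - 1\<close> lies in the kernel of
  \<open>Q'\<close>; it vanishes on the zero forcing set \<open>Z\<close>, hence everywhere.
\<close>

section \<open>Induction along single forces\<close>

text \<open>\<open>force_step\<close> performs many forces at once, whereas the induction adds one
  vertex at a time. This is reconciled by a maximal set \<open>B\<close> above \<open>Z\<close>
  satisfying \<open>P\<close>: a force available in some \<open>X\<close> inside \<open>B\<close>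
  stays available in \<open>B\<close> unless its target is already there, so by maximality
  \<open>B\<close> absorbs every round of colouring.\<close>

lemma zero_forcing_induct [consumes 1, case_names initial force]:
  fixes Z :: "'v::finite set"
  assumes "zero_forcing_set E Z"
    and initial: "P Z"
    and force: "\<And>B i v. Z \<subseteq> B \<Longrightarrow> P B \<Longrightarrow> i \<in> B \<Longrightarrow> neighbours E i - B = {v} \<Longrightarrow> P (insert v B)"
  shows "P UNIV"
proof -
  obtain B where B: "Z \<subseteq> B" "P B" and max: "\<And>C. Z \<subseteq> C \<Longrightarrow> P C \<Longrightarrow> B \<subseteq> C \<Longrightarrow> C = B"
    using finite_has_maximal2[of "{B. Z \<subseteq> B \<and> P B}" Z] initial
    by (metis (no_types, lifting) finite mem_Collect_eq order_refl)
  have "force_step E X \<subseteq> B" if "X \<subseteq> B" for X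
  proof
    fix j assume "j \<in> force_step E X"
    then consider "j \<in> X" | i where "i \<in> X" "neighbours E i - X = {j}"
      unfolding force_step_def by blast
    then show "j \<in> B"
    proof cases
      case 1
      then show ?thesis using that by blast
    next
      case 2
      show ?thesis
      proof (rule ccontr)
        assume "j \<notin> B"
        then have "neighbours E i - B = {j}" using 2 that by blast
        then have "P (insert j B)" using force B 2 that by blast
        then show False using max[of "insert j B"] B \<open>j \<notin> B\<close> by blast
      qed
    qed
  qed
  then have "(force_step E ^^ n) Z \<subseteq> B" for n
    by (induction n) (auto simp: B)
  then have "B = UNIV"
    using assms(1) unfolding zero_forcing_set_def by (metis top.extremum_uniqueI)
  then show ?thesis using B by simp
qed

section \<open>Recovering entries of matrix powers from the dynamics\<close>

lemma matrix_pow_Suc_right: "matrix_pow A (Suc k) = matrix_pow A k ** A"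
  by (induction k) (simp_all add: matrix_mul_assoc)

lemma matrix_pow_Suc_nth:
  "matrix_pow A (Suc k) $ i $ j = (\<Sum>l\<in>UNIV. A $ i $ l * matrix_pow A k $ l $ j)"
  by (simp add: matrix_matrix_mult_def)

lemma matrix_pow_Suc_right_nth:
  "matrix_pow A (Suc k) $ i $ j = (\<Sum>l\<in>UNIV. matrix_pow A k $ i $ l * A $ l $ j)"
  unfolding matrix_pow_Suc_right by (simp add: matrix_matrix_mult_def)

lemma matrix_pow_scaleR_nth: "matrix_pow (t *\<^sub>R A) k $ i $ j = t ^ k * matrix_pow A k $ i $ j"
  by (induction k arbitrary: i)
    (simp_all add: matrix_matrix_mult_def sum_distrib_left algebra_simps)

lemma transition_matrix_nth_sums:
  fixes Q :: "real^'n^'n"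
  shows "(\<lambda>k. matrix_pow Q k $ i $ j / fact k * t ^ k) sums (transition_matrix Q t $ i $ j)"
proof -
  have "bounded_linear (\<lambda>M::real^'n^'n. M $ i $ j)"
    by (rule bounded_linear_compose[OF bounded_linear_vec_nth bounded_linear_vec_nth])
  from bounded_linear.sums[OF this matrix_exp_sums[of "t *\<^sub>R Q"]]
  show ?thesis
    by (simp add: transition_matrix_def matrix_pow_scaleR_nth mult.commute)
qed

text \<open>Zeros of a nontrivial power series are isolated, so vanishing on the half-line
  \<open>t \<ge> 0\<close> already kills all coefficients.\<close>

lemma powser_coeff_zero:
  fixes a :: "nat \<Rightarrow> real"
  assumes zero: "\<And>t. t \<ge> 0 \<Longrightarrow> (\<lambda>k. a k * t ^ k) sums 0"
    and summable: "\<And>t. summable (\<lambda>k. a k * t ^ k)"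
  shows "a m = 0"
proof (rule ccontr)
  assume "a m \<noteq> 0"
  \<comment> \<open>Isolation of the zero at \<open>0\<close> requires the series to vanish there
    and a nonzero coefficient of positive index; the radius \<open>1\<close> below is
    arbitrary.\<close>
  moreover have a0: "a 0 = 0"
    using zero[of 0] by simp
  ultimately have "m > 0"
    by (metis gr0I)
  obtain s where "s > 0" and nz: "\<And>t. t \<in> cball 0 s - {0} \<Longrightarrow> (\<Sum>k. a k * t ^ k) \<noteq> 0"
  proof (rule powser_0_nonzero[of 1 0 a "\<lambda>t. \<Sum>k. a k * t ^ k" m])
    show "(\<lambda>k. a k * (t - 0) ^ k) sums (\<Sum>k. a k * t ^ k)" for t
      using summable_sums[OF summable] by simp
  qed (use \<open>a m \<noteq> 0\<close> \<open>m > 0\<close> a0 in auto)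
  moreover have "(\<Sum>k. a k * s ^ k) = 0"
    using zero[of s] \<open>s > 0\<close> by (simp add: sums_iff)
  ultimately show False
    using nz[of s] by simp
qed

lemma matrix_pow_nth_eq:
  assumes "\<And>t. t \<ge> 0 \<Longrightarrow> transition_matrix Q' t $ i $ j = transition_matrix Q t $ i $ j"
  shows "matrix_pow Q' k $ i $ j = matrix_pow Q k $ i $ j"
proof -
  let ?a = "\<lambda>k. matrix_pow Q' k $ i $ j / fact k - matrix_pow Q k $ i $ j / fact k"
  have "(\<lambda>k. ?a k * t ^ k) sums (transition_matrix Q' t $ i $ j - transition_matrix Q t $ i $ j)" for t
    using sums_diff[OF transition_matrix_nth_sums transition_matrix_nth_sums]
    by (simp add: left_diff_distrib)
  then have "?a k = 0"
    using assms by (intro powser_coeff_zero) (auto simp: sums_iff)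
  then show ?thesis by (simp add: field_simps)
qed

section \<open>Sparsity of rows and columns at a forcing vertex\<close>

lemma matrix_graph_neighbours:
  assumes "combinatorially_symmetric Q"
  shows "neighbours (matrix_graph Q) i = {j. j \<noteq> i \<and> Q $ i $ j \<noteq> 0}"
  using assms unfolding neighbours_def matrix_graph_def combinatorially_symmetric_def
  by (auto simp: doubleton_eq_iff)

text \<open>Row \<open>i\<close> is supported on \<open>i\<close> and its neighbours, and
  \<open>v\<close> is the only one of these outside \<open>B\<close>.\<close>

lemma sum_row_force:
  fixes Q :: "real^'n^'n"
  assumes "combinatorially_symmetric Q" "i \<in> B" "neighbours (matrix_graph Q) i - B = {v}"
  shows "(\<Sum>l\<in>UNIV. Q $ i $ l * f l) = Q $ i $ v * f v + (\<Sum>l\<in>B. Q $ i $ l * f l)"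
proof -
  have "(\<Sum>l\<in>UNIV. Q $ i $ l * f l) = (\<Sum>l\<in>insert v B. Q $ i $ l * f l)"
    using assms by (intro sum.mono_neutral_right) (auto simp: matrix_graph_neighbours)
  also have "\<dots> = Q $ i $ v * f v + (\<Sum>l\<in>B. Q $ i $ l * f l)"
    using assms(3) by (intro sum.insert) auto
  finally show ?thesis .
qed

text \<open>Combinatorial symmetry transfers the support of row \<open>i\<close> to column
  \<open>i\<close>.\<close>

lemma sum_column_force:
  fixes Q :: "real^'n^'n"
  assumes "combinatorially_symmetric Q" "i \<in> B" "neighbours (matrix_graph Q) i - B = {v}"
  shows "(\<Sum>l\<in>UNIV. f l * Q $ l $ i) = f v * Q $ v $ i + (\<Sum>l\<in>B. f l * Q $ l $ i)"
proof -
  have "Q $ l $ i = 0" if "l \<notin> insert v B" for l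
    using assms that unfolding matrix_graph_neighbours[OF assms(1)] combinatorially_symmetric_def
    by blast
  then have "(\<Sum>l\<in>UNIV. f l * Q $ l $ i) = (\<Sum>l\<in>insert v B. f l * Q $ l $ i)"
    by (intro sum.mono_neutral_right) auto
  also have "\<dots> = f v * Q $ v $ i + (\<Sum>l\<in>B. f l * Q $ l $ i)"
    using assms(3) by (intro sum.insert) auto
  finally show ?thesis .
qed

section \<open>Extending the diagonal similarity by a force\<close>

text \<open>With \<open>D\<close> the diagonal matrix of \<open>d\<close>, this is the
  \<open>B\<close>-block of \<open>Q'^k D = D Q^k\<close>. The powers are those of the full
  matrices, so for a proper subset \<open>B\<close> the case \<open>k = 1\<close> does not yield the
  others.\<close>

definition similar_powers_on ::
    "real^'n^'n \<Rightarrow> real^'n^'n \<Rightarrow> ('n \<Rightarrow> real) \<Rightarrow> 'n set \<Rightarrow> bool" where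
  "similar_powers_on Q' Q d B \<longleftrightarrow>
     (\<forall>k. \<forall>i\<in>B. \<forall>j\<in>B. matrix_pow Q' k $ i $ j * d j = d i * matrix_pow Q k $ i $ j)"

lemma similar_powers_on_nth:
  assumes "similar_powers_on Q' Q d B" "i \<in> B" "j \<in> B"
  shows "Q' $ i $ j * d j = d i * Q $ i $ j"
proof -
  have "matrix_pow Q' 1 $ i $ j * d j = d i * matrix_pow Q 1 $ i $ j"
    using assms unfolding similar_powers_on_def by blast
  then show ?thesis by simp
qed

text \<open>Expanding entry \<open>(i, j)\<close> of the power \<open>k + 1\<close> along row
  \<open>i\<close> leaves one unknown term, \<open>Q $ i $ v\<close> times entry
  \<open>(v, j)\<close> of the power \<open>k\<close>; dividing by the nonzero edge entry determines
  it. Column \<open>i\<close> treats the entries \<open>(j, v)\<close> in the same way.\<close>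

lemma similar_powers_on_insert:
  fixes Q Q' :: "real^'n^'n"
  assumes sym: "combinatorially_symmetric Q" "combinatorially_symmetric Q'"
    and graph: "matrix_graph Q' = matrix_graph Q"
    and nz: "\<And>i. d i \<noteq> 0"
    and sim: "similar_powers_on Q' Q d B"
    and i: "i \<in> B" and v: "neighbours (matrix_graph Q) i - B = {v}"
  shows "similar_powers_on Q' Q (d(v := d i * Q $ i $ v / Q' $ i $ v)) (insert v B)"
proof -
  \<comment> \<open>The value at \<open>v\<close> is the one that makes the similarity hold at the
    entry \<open>(i, v)\<close>; on \<open>B\<close> nothing changes.\<close>
  define e where "e = d(v := d i * Q $ i $ v / Q' $ i $ v)"
  have vB: "v \<notin> B" using v by blast
  have v': "neighbours (matrix_graph Q') i - B = {v}" using v graph by simp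
  have Q_iv: "Q $ i $ v \<noteq> 0" "Q' $ i $ v \<noteq> 0"
    using v v' matrix_graph_neighbours[OF sym(1)] matrix_graph_neighbours[OF sym(2)] by blast+
  have Q_vi: "Q $ v $ i \<noteq> 0"
    using Q_iv sym unfolding combinatorially_symmetric_def by blast
  have e_nz: "e l \<noteq> 0" for l
    using nz Q_iv by (simp add: e_def)
  have sim_e: "matrix_pow Q' k $ l $ j * e j = e l * matrix_pow Q k $ l $ j"
    if "l \<in> B" "j \<in> B" for k l j
    using sim that vB unfolding similar_powers_on_def e_def by auto
  have sim_e1: "Q' $ l $ j * e j = e l * Q $ l $ j" if "l \<in> B" "j \<in> B" for l j
    using similar_powers_on_nth[OF sim that] that vB by (auto simp: e_def)
  have edge: "Q' $ i $ v * e v = e i * Q $ i $ v"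
    using Q_iv i vB by (auto simp: e_def)
  \<comment> \<open>The column \<open>j\<close> is left arbitrary, as the argument serves first for
    \<open>j\<close> in \<open>B\<close> and finally for \<open>j = v\<close>.\<close>
  have row: "matrix_pow Q' k $ v $ j * e j = e v * matrix_pow Q k $ v $ j"
    if col: "\<And>k l. l \<in> B \<Longrightarrow> matrix_pow Q' k $ l $ j * e j = e l * matrix_pow Q k $ l $ j" for k j
  proof -
    have terms: "Q' $ i $ l * matrix_pow Q' k $ l $ j * e j = e i * (Q $ i $ l * matrix_pow Q k $ l $ j)"
      if "l \<in> B" for l
    proof -
      have "Q' $ i $ l * matrix_pow Q' k $ l $ j * e j = Q' $ i $ l * e l * matrix_pow Q k $ l $ j"
        by (simp only: col[OF that] mult.assoc)
      then show ?thesis by (simp only: sim_e1[OF i that] mult.assoc)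
    qed
    have "Q' $ i $ v * (matrix_pow Q' k $ v $ j * e j)
        + (\<Sum>l\<in>B. Q' $ i $ l * matrix_pow Q' k $ l $ j * e j) = matrix_pow Q' (Suc k) $ i $ j * e j"
      unfolding matrix_pow_Suc_nth sum_row_force[OF sym(2) i v']
      by (simp add: distrib_right sum_distrib_right)
    also have "\<dots> = e i * matrix_pow Q (Suc k) $ i $ j"
      using col[OF i] .
    also have "\<dots> = e i * Q $ i $ v * matrix_pow Q k $ v $ j
        + (\<Sum>l\<in>B. e i * (Q $ i $ l * matrix_pow Q k $ l $ j))"
      unfolding matrix_pow_Suc_nth sum_row_force[OF sym(1) i v]
      by (simp add: distrib_left sum_distrib_left)
    finally have "Q' $ i $ v * (matrix_pow Q' k $ v $ j * e j) = Q' $ i $ v * e v * matrix_pow Q k $ v $ j"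
      using terms edge by simp
    then show ?thesis using Q_iv by simp
  qed
  have row_B: "matrix_pow Q' k $ v $ j * e j = e v * matrix_pow Q k $ v $ j" if "j \<in> B" for k j
    using row sim_e that by blast
  \<comment> \<open>The power \<open>1\<close> gives the similarity at the reversed edge, the
    coefficient of the unknown term in the column expansion.\<close>
  have edge': "Q' $ v $ i * e i = e v * Q $ v $ i"
    using row_B[OF i, of 1] by simp
  have column: "matrix_pow Q' k $ j $ v * e v = e j * matrix_pow Q k $ j $ v" if j: "j \<in> B" for k j
  proof -
    have terms: "matrix_pow Q' k $ j $ l * Q' $ l $ i * e i = e j * (matrix_pow Q k $ j $ l * Q $ l $ i)"
      if "l \<in> B" for l
    proof -
      have "matrix_pow Q' k $ j $ l * Q' $ l $ i * e i = matrix_pow Q' k $ j $ l * e l * Q $ l $ i"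
        by (simp only: sim_e1[OF that i] mult.assoc)
      then show ?thesis by (simp only: sim_e[OF j that] mult.assoc)
    qed
    have "matrix_pow Q' k $ j $ v * (Q' $ v $ i * e i)
        + (\<Sum>l\<in>B. matrix_pow Q' k $ j $ l * Q' $ l $ i * e i) = matrix_pow Q' (Suc k) $ j $ i * e i"
      unfolding matrix_pow_Suc_right_nth sum_column_force[OF sym(2) i v']
      by (simp add: distrib_right sum_distrib_right)
    also have "\<dots> = e j * matrix_pow Q (Suc k) $ j $ i"
      using sim_e[OF j i] .
    also have "\<dots> = e j * matrix_pow Q k $ j $ v * Q $ v $ i
        + (\<Sum>l\<in>B. e j * (matrix_pow Q k $ j $ l * Q $ l $ i))"
      unfolding matrix_pow_Suc_right_nth sum_column_force[OF sym(1) i v]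
      by (simp add: distrib_left sum_distrib_left)
    finally have "matrix_pow Q' k $ j $ v * e v * Q $ v $ i = e j * matrix_pow Q k $ j $ v * Q $ v $ i"
      using terms edge' by simp
    then show ?thesis using Q_vi by simp
  qed
  \<comment> \<open>Now \<open>column\<close> supplies the premise of \<open>row\<close> for
    \<open>j = v\<close>.\<close>
  have "matrix_pow Q' k $ v $ v * e v = e v * matrix_pow Q k $ v $ v" for k
    using row column by blast
  then show ?thesis
    using sim_e row_B column unfolding similar_powers_on_def e_def[symmetric] by blast
qed

section \<open>Removing the diagonal freedom\<close>

lemma transition_rate_matrix_row_sum:
  assumes "transition_rate_matrix Q"
  shows "(\<Sum>j\<in>UNIV. Q $ i $ j) = 0"
proof -
  have "(\<Sum>j\<in>UNIV. Q $ i $ j) = Q $ i $ i + (\<Sum>j\<in>UNIV - {i}. Q $ i $ j)"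
    by (rule sum.remove) auto
  moreover have "Q $ i $ i = - (\<Sum>j\<in>UNIV - {i}. Q $ i $ j)"
    using assms unfolding transition_rate_matrix_def by blast
  ultimately show ?thesis by linarith
qed

text \<open>If \<open>w\<close> vanishes on \<open>B\<close>, row \<open>i\<close> of the kernel
  equation reduces to \<open>Q $ i $ v * w v = 0\<close>, so zeros propagate along forces.\<close>

lemma zero_forcing_kernel:
  fixes Q :: "real^'n^'n"
  assumes sym: "combinatorially_symmetric Q"
    and forcing: "zero_forcing_set (matrix_graph Q) Z"
    and kernel: "\<And>i. (\<Sum>j\<in>UNIV. Q $ i $ j * w j) = 0"
    and zero: "\<And>i. i \<in> Z \<Longrightarrow> w i = 0"
  shows "w i = 0"
proof -
  from forcing have "\<forall>i\<in>UNIV. w i = 0"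
  proof (induction rule: zero_forcing_induct)
    case initial
    show ?case using zero by blast
  next
    case (force B i v)
    have "Q $ i $ v * w v = 0"
      using sum_row_force[OF sym force.hyps(2,3), of w] kernel[of i] force.IH by simp
    moreover have "Q $ i $ v \<noteq> 0"
      using force.hyps(3) matrix_graph_neighbours[OF sym] by blast
    ultimately show ?case using force.IH by simp
  qed
  then show ?thesis by simp
qed

theorem theorem2:
  fixes Q Q' :: "real^'n^'n" and Z :: "'n set"
  assumes "transition_rate_matrix Q" and "combinatorially_symmetric Q"
    and "zero_forcing_set (matrix_graph Q) Z"
    and "transition_rate_matrix Q'" and "combinatorially_symmetric Q'"
    and "matrix_graph Q' = matrix_graph Q"
    and "\<And>i j t. i \<in> Z \<Longrightarrow> j \<in> Z \<Longrightarrow> t \<ge> 0 \<Longrightarrow>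
           transition_matrix Q' t $ i $ j = transition_matrix Q t $ i $ j"
  shows "Q' = Q"
proof -
  from assms(3) have "\<exists>d. (\<forall>i. d i \<noteq> 0) \<and> (\<forall>i\<in>Z. d i = 1) \<and> similar_powers_on Q' Q d UNIV"
  proof (induction rule: zero_forcing_induct)
    case initial
    have "similar_powers_on Q' Q (\<lambda>_. 1) Z"
      using matrix_pow_nth_eq[OF assms(7)] unfolding similar_powers_on_def by simp
    then show ?case by (intro exI[of _ "\<lambda>_. 1"]) simp
  next
    case (force B i v)
    from force.IH obtain d where d: "\<And>i. d i \<noteq> 0" "\<And>i. i \<in> Z \<Longrightarrow> d i = 1" "similar_powers_on Q' Q d B"
      by blast
    let ?e = "d(v := d i * Q $ i $ v / Q' $ i $ v)"
    have "Q $ i $ v \<noteq> 0" "Q' $ i $ v \<noteq> 0"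
      using force.hyps(3) assms(6) matrix_graph_neighbours[OF assms(2)]
        matrix_graph_neighbours[OF assms(5)] by fastforce+
    \<comment> \<open>Since \<open>v\<close> lies outside \<open>B\<close>, which contains
      \<open>Z\<close>, changing \<open>d\<close> at \<open>v\<close> keeps the normalisation on
      \<open>Z\<close>.\<close>
    moreover have "v \<notin> Z" using force.hyps(1,3) by blast
    ultimately have "(\<forall>i. ?e i \<noteq> 0) \<and> (\<forall>i\<in>Z. ?e i = 1)"
      using d by auto
    then show ?case
      using similar_powers_on_insert[OF assms(2,5,6) d(1,3) force.hyps(2,3)] by blast
  qed
  then obtain d where d: "\<And>i. d i \<noteq> 0" "\<And>i. i \<in> Z \<Longrightarrow> d i = 1" "similar_powers_on Q' Q d UNIV"
    by blast
  have sim: "Q' $ i $ j * d j = d i * Q $ i $ j" for i j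
    using similar_powers_on_nth[OF d(3)] by simp
  \<comment> \<open>Summing \<open>sim\<close> over \<open>j\<close> turns the zero row sum of
    \<open>Q\<close> into the vanishing of \<open>Q'\<close> applied to \<open>d\<close>.\<close>
  have kernel: "(\<Sum>j\<in>UNIV. Q' $ i $ j * (d j - 1)) = 0" for i
    by (simp add: right_diff_distrib sum_subtractf sim sum_distrib_left[symmetric]
        transition_rate_matrix_row_sum assms(1,4))
  have "zero_forcing_set (matrix_graph Q') Z"
    using assms(3,6) by simp
  then have "d i - 1 = 0" for i
    by (rule zero_forcing_kernel[OF assms(5) _ kernel]) (simp add: d(2))
  then show ?thesis
    using sim by (simp add: vec_eq_iff)
qed

end
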